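(* Let $\theta>0$ and let $X_1,X_2,\dots$ be an exchangeable sequence obtained by i.i.d. sampling from the $\mathsf{GEM}(0,\theta)$ random discrete distribution. For each fixed $n\ge 1$, the gaps $G_{i:n}$, $1\le i\le n$, between the order statistics of $X_1,\dots,X_n$, defined by $G_{i:n}:=X_{n+1-i:n}-X_{n-i:n}$ for $1\le i\le n-1$ and $G_{n:n}:=X_{1:n}-1=\min_{1\le i\le n}X_i-1$, are independent, and $G_{i:n}$ has the geometric$(i/(i+\theta))$ distribution, with mean $\theta/i$, for $1\le i\le n$.
   Context: The $\mathsf{GEM}(0,\theta)$ distribution is the law of the random probability distribution $P_\bullet=(P_1,P_2,\dots)$ on $\{1,2,\dots\}$ given by $P_j:=H_j\prod_{i=1}^{j-1}(1-H_i)$, where $H_1,H_2,\dots$ are i.i.d. beta$(1,\theta)$ random variables (density $\theta(1-x)^{\theta-1}$ on $(0,1)$). An i.i.d. sample from $P_\bullet$ means that, conditionally given $P_\bullet$, the variables $X_1,X_2,\dots$ are i.i.d. with $\mathbb{P}(X_i=b\mid P_\bullet)=P_b$ for $b=1,2,\dots$. The order statistics are $X_{1:n}\le X_{2:n}\le\cdots\le X_{n:n}$. The geometric$(p)$ distribution is on $\{0,1,2,\dots\}$: $\mathbb{P}(G=k)=p(1-p)^k$, with mean $(1-p)/p$. *)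

theory Defs
  imports "HOL-Probability.Probability"
begin

text \<open>Throughout, sequences indexed by $1, 2, \dots$ are rendered with index set \<open>{1..}\<close>; a random
  sequence of reals is a random element of \<open>\<Pi>\<^sub>M j\<in>{1..}. borel\<close>.\<close>

abbreviation seq_borel :: "(nat \<Rightarrow> real) measure" where
  "seq_borel \<equiv> \<Pi>\<^sub>M j\<in>{1..}. borel"

definition beta1_measure :: "real \<Rightarrow> real measure" where
  "beta1_measure \<theta> =
     density lborel (\<lambda>x. ennreal (indicator {0<..<1} x * (\<theta> * (1 - x) powr (\<theta> - 1))))"

definition stick_breaking :: "(nat \<Rightarrow> real) \<Rightarrow> nat \<Rightarrow> real" where
  "stick_breaking h = (\<lambda>j\<in>{1..}. h j * (\<Prod>i=1..<j. 1 - h i))"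

text \<open>The law of \<open>stick_breaking H\<close>, where the entries of \<open>H\<close> are i.i.d., i.e. the law of \<open>H\<close> is
  the infinite product of copies of \<open>beta1_measure \<theta>\<close>.\<close>

definition GEM0 :: "real \<Rightarrow> (nat \<Rightarrow> real) measure" where
  "GEM0 \<theta> = distr (\<Pi>\<^sub>M j\<in>{1..}. beta1_measure \<theta>) seq_borel stick_breaking"

definition cond_prob_given :: "'a measure \<Rightarrow> 'a measure \<Rightarrow> 'a set \<Rightarrow> 'a \<Rightarrow> real" where
  "cond_prob_given M F A = real_cond_exp M F (indicator A)"

text \<open>Conditional analogue of \<^const>\<open>prob_space.indep_vars\<close>, given a sub-sigma-algebra \<open>F\<close> of \<open>M\<close>.\<close>

definition cond_indep_vars ::
  "'a measure \<Rightarrow> 'a measure \<Rightarrow> ('i \<Rightarrow> 'b measure) \<Rightarrow> ('i \<Rightarrow> 'a \<Rightarrow> 'b) \<Rightarrow> 'i set \<Rightarrow> bool" where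
  "cond_indep_vars M F N X I \<longleftrightarrow>
     (\<forall>i\<in>I. X i \<in> measurable M (N i)) \<and>
     (\<forall>J\<subseteq>I. J \<noteq> {} \<longrightarrow> finite J \<longrightarrow> (\<forall>A\<in>Pi J (\<lambda>j. sets (N j)).
        AE \<omega> in M. cond_prob_given M F (\<Inter>j\<in>J. X j -` A j \<inter> space M) \<omega>
                 = (\<Prod>j\<in>J. cond_prob_given M F (X j -` A j \<inter> space M) \<omega>)))"

text \<open>\<open>P\<close> is a random element with law \<open>GEM0 \<theta>\<close> and, given the sigma-algebra generated by \<open>P\<close>, the
  variables \<open>X 1, X 2, \<dots>\<close> are independent, each with distribution \<open>P\<close> on $\{1, 2, \dots\}$.\<close>

definition GEM_sample ::
  "'a measure \<Rightarrow> real \<Rightarrow> ('a \<Rightarrow> nat \<Rightarrow> real) \<Rightarrow> (nat \<Rightarrow> 'a \<Rightarrow> nat) \<Rightarrow> bool" where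
  "GEM_sample M \<theta> P X \<longleftrightarrow>
     P \<in> measurable M seq_borel \<and> distr M seq_borel P = GEM0 \<theta> \<and>
     (let \<sigma>P = vimage_algebra (space M) P seq_borel in
        cond_indep_vars M \<sigma>P (\<lambda>_. count_space {1..}) X {1..} \<and>
        (\<forall>i\<ge>1. \<forall>b\<ge>1. AE \<omega> in M. cond_prob_given M \<sigma>P {\<omega> \<in> space M. X i \<omega> = b} \<omega> = P \<omega> b))"

text \<open>The order statistic $X_{k:n}$ is \<open>order_stat X n k\<close>, for $1 \le k \le n$.\<close>

definition order_stat :: "(nat \<Rightarrow> 'a \<Rightarrow> nat) \<Rightarrow> nat \<Rightarrow> nat \<Rightarrow> 'a \<Rightarrow> nat" where
  "order_stat X n k \<omega> = sort (map (\<lambda>j. X j \<omega>) [1..<Suc n]) ! (k - 1)"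

text \<open>The gap $G_{i:n}$ is \<open>gap X n i\<close>, for $1 \le i \le n$. Natural-number subtraction does not
  truncate here: order statistics increase in \<open>k\<close>, and samples take values in \<open>{1..}\<close>.\<close>

definition gap :: "(nat \<Rightarrow> 'a \<Rightarrow> nat) \<Rightarrow> nat \<Rightarrow> nat \<Rightarrow> 'a \<Rightarrow> nat" where
  "gap X n i \<omega> =
     (if i < n then order_stat X n (n + 1 - i) \<omega> - order_stat X n (n - i) \<omega>
      else order_stat X n 1 \<omega> - 1)"

lemma order_stat_1_eq_Min:
  assumes "n \<ge> 1"
  shows "order_stat X n 1 \<omega> = Min ((\<lambda>j. X j \<omega>) ` {1..n})"
proof -
  let ?xs = "map (\<lambda>j. X j \<omega>) [1..<Suc n]"
  have set_xs: "set ?xs = (\<lambda>j. X j \<omega>) ` {1..n}" by auto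
  have ne: "sort ?xs \<noteq> []"
    using assms by (metis length_greater_0_conv length_map length_sort length_upt
        diff_Suc_1 less_le_trans zero_less_one)
  have "sort ?xs ! 0 \<in> set ?xs"
    using ne by (metis length_greater_0_conv nth_mem set_sort)
  moreover have "sort ?xs ! 0 \<le> y" if y: "y \<in> set ?xs" for y
  proof -
    from y obtain k where "k < length (sort ?xs)" "y = sort ?xs ! k"
      by (metis in_set_conv_nth set_sort)
    then show ?thesis using sorted_nth_mono[OF sorted_sort, of 0 k ?xs] by simp
  qed
  ultimately have "sort ?xs ! 0 = Min (set ?xs)" by (intro Min_eqI[symmetric]) auto
  then show ?thesis unfolding order_stat_def set_xs by simp
qed

end

theory Submission
  imports Defs "HOL-Combinatorics.Multiset_Permutations"
begin

text \<open>Given the stick lengths \<open>H\<close>, the probability of observing a particular sample $x_1,\dots,x_n$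
  is $\prod_j P_{x_j} = \prod_b H_b^{c_b} (1 - H_b)^{d_b}$, where $c_b$ is the number of sample points
  equal to \<open>b\<close> and $d_b$ the number of sample points beyond \<open>b\<close>. Its expectation is a product of beta
  moments, which are $c_b! \, \frac{\theta}{d_b + \theta}$ times a ratio of rising factorials of
  \<open>\<theta> + 1\<close> with indices $d_b$ and $d_{b-1} = c_b + d_b$. These ratios telescope
  (\<open>GEM0_mixed_moment\<close>).

  Multiplying by the number $n! / \prod_b c_b!$ of arrangements of the sample gives the law of the
  unordered sample (\<open>prob_sample_mset\<close>):
  $$\prod_{i=1}^n \frac{i}{i + \theta} \; \prod_b \frac{\theta}{d_b + \theta}.$$
  The unordered sample and the vector of gaps determine each other (\<open>gap_eq_iff_mset_eq\<close>), and
  the number of values \<open>b\<close> with $d_b = i$ is exactly the gap $G_{i:n}$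
  (\<open>prod_over_values_eq_prod_over_gaps\<close>). So the joint mass function of the gaps at \<open>g\<close> is
  $\prod_{i=1}^n \frac{i}{i+\theta} \bigl(\frac{\theta}{i+\theta}\bigr)^{g_i}$, a product of geometric
  mass functions. This gives independence and the marginal laws at once
  (\<open>indep_vars_of_joint_pmf\<close>).\<close>

section \<open>Moments of the beta distribution\<close>

lemma sets_beta1_measure [measurable_cong]: "sets (beta1_measure \<theta>) = sets borel"
  by (simp add: beta1_measure_def)

text \<open>The moment \<open>E (H\<^sup>c (1 - H)\<^sup>d)\<close> of a beta$(1,\theta)$ variable is \<open>\<theta> * Beta (c + 1) (d + \<theta>)\<close>. Writing
  the Gamma functions as rising factorials turns it into a ratio with \<open>d\<close> above and \<open>c + d\<close> below;
  this is the form in which the moments for successive sticks telescope.\<close>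

lemma theta_Beta_eq_pochhammer_ratio:
  fixes \<theta> :: real
  assumes "\<theta> > 0"
  shows "\<theta> * Beta (real c + 1) (real d + \<theta>) =
    fact c * (\<theta> / (real d + \<theta>)) * (pochhammer (\<theta> + 1) d / pochhammer (\<theta> + 1) (c + d))"
proof -
  have nonpole: "\<theta> + 1 \<notin> \<int>\<^sub>\<le>\<^sub>0"
    using assms by (auto elim!: nonpos_Ints_cases)
  have Gamma_pos: "Gamma (\<theta> + 1) > 0" "Gamma (real d + \<theta>) > 0"
    using assms by (auto intro: Gamma_real_pos)
  have "pochhammer (\<theta> + 1) d = Gamma (real d + \<theta> + 1) / Gamma (\<theta> + 1)"
    using nonpole by (simp add: pochhammer_Gamma add_ac)
  also have "Gamma (real d + \<theta> + 1) = (real d + \<theta>) * Gamma (real d + \<theta>)"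
    using assms by (intro Gamma_plus1) (auto elim!: nonpos_Ints_cases)
  finally have d: "pochhammer (\<theta> + 1) d = (real d + \<theta>) * Gamma (real d + \<theta>) / Gamma (\<theta> + 1)" .
  have cd: "pochhammer (\<theta> + 1) (c + d) = Gamma (real c + 1 + (real d + \<theta>)) / Gamma (\<theta> + 1)"
    using nonpole by (simp add: pochhammer_Gamma add_ac)
  have "real d + \<theta> \<noteq> 0" using assms by linarith
  moreover have "Gamma (real c + 1) = fact c"
    by (metis Gamma_fact add.commute)
  moreover have "\<theta> * (u * v / w) = u * (\<theta> / k) * ((k * v / z) / (w / z))"
    if "k \<noteq> 0" "z \<noteq> 0" for u v w k z :: real
    using that by simp
  ultimately show ?thesis
    using Gamma_pos unfolding d cd Beta_def by (metis less_irrefl)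
qed

lemma nn_integral_beta1_moment:
  fixes \<theta> :: real
  assumes "\<theta> > 0"
  shows "(\<integral>\<^sup>+x. ennreal (x ^ c * (1 - x) ^ d) \<partial>beta1_measure \<theta>) =
    ennreal (\<theta> * Beta (real c + 1) (real d + \<theta>))"
proof -
  have "((\<lambda>x. \<theta> * (x powr (real c + 1 - 1) * (1 - x) powr (real d + \<theta> - 1)))
      has_integral \<theta> * Beta (real c + 1) (real d + \<theta>)) {0<..<1}"
    using has_integral_Beta_real[of "real c + 1" "real d + \<theta>"] assms
    by (intro has_integral_mult_right) (simp add: has_integral_Icc_iff_Ioo)
  then have "(\<integral>\<^sup>+x. ennreal (\<theta> * (x powr (real c + 1 - 1) * (1 - x) powr (real d + \<theta> - 1)))
      * indicator {0<..<1} x \<partial>lborel) = ennreal (\<theta> * Beta (real c + 1) (real d + \<theta>))"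
    using assms by (intro nn_integral_has_integral_lebesgue') auto
  moreover have "(\<integral>\<^sup>+x. ennreal (x ^ c * (1 - x) ^ d) \<partial>beta1_measure \<theta>) =
    (\<integral>\<^sup>+x. ennreal (\<theta> * (x powr (real c + 1 - 1) * (1 - x) powr (real d + \<theta> - 1)))
      * indicator {0<..<1} x \<partial>lborel)"
    unfolding beta1_measure_def
  proof (subst nn_integral_density)
    show "(\<integral>\<^sup>+x. ennreal (indicator {0<..<1} x * (\<theta> * (1 - x) powr (\<theta> - 1)))
        * ennreal (x ^ c * (1 - x) ^ d) \<partial>lborel) =
      (\<integral>\<^sup>+x. ennreal (\<theta> * (x powr (real c + 1 - 1) * (1 - x) powr (real d + \<theta> - 1)))
      * indicator {0<..<1} x \<partial>lborel)"
    proof (rule nn_integral_cong)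
      fix x :: real
      show "ennreal (indicator {0<..<1} x * (\<theta> * (1 - x) powr (\<theta> - 1)))
          * ennreal (x ^ c * (1 - x) ^ d) =
        ennreal (\<theta> * (x powr (real c + 1 - 1) * (1 - x) powr (real d + \<theta> - 1)))
          * indicator {0<..<1} x"
      proof (cases "0 < x \<and> x < 1")
        case True
        have "(1 - x) powr (real d + \<theta> - 1) = (1 - x) powr real d * (1 - x) powr (\<theta> - 1)"
          by (simp flip: powr_add add: algebra_simps)
        then have "(1 - x) powr (real d + \<theta> - 1) = (1 - x) ^ d * (1 - x) powr (\<theta> - 1)"
          using True by (simp add: powr_realpow)
        then show ?thesis
          using True assms by (simp add: powr_realpow mult_ac flip: ennreal_mult)
      qed (auto simp: indicator_def)
    qed
  qed auto
  ultimately show ?thesis by simp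
qed

lemma prob_space_beta1_measure:
  assumes "\<theta> > 0"
  shows "prob_space (beta1_measure \<theta>)"
proof
  show "emeasure (beta1_measure \<theta>) (space (beta1_measure \<theta>)) = 1"
    using nn_integral_beta1_moment[OF assms, of 0 0] theta_Beta_eq_pochhammer_ratio[OF assms, of 0 0] assms
    by simp
qed

lemma AE_beta1_measure:
  assumes "\<theta> > 0"
  shows "AE x in beta1_measure \<theta>. 0 < x \<and> x < 1"
  unfolding beta1_measure_def by (subst AE_density) (auto simp: indicator_def)

lemma beta1_moment:
  assumes "\<theta> > 0"
  shows "has_bochner_integral (beta1_measure \<theta>) (\<lambda>x. x ^ c * (1 - x) ^ d)
    (fact c * (\<theta> / (real d + \<theta>)) * (pochhammer (\<theta> + 1) d / pochhammer (\<theta> + 1) (c + d)))"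
proof (rule has_bochner_integral_nn_integral)
  show "AE x in beta1_measure \<theta>. 0 \<le> x ^ c * (1 - x) ^ d"
    using AE_beta1_measure[OF assms] by eventually_elim auto
  show "0 \<le> fact c * (\<theta> / (real d + \<theta>)) * (pochhammer (\<theta> + 1) d / pochhammer (\<theta> + 1) (c + d))"
    using assms by (intro mult_nonneg_nonneg divide_nonneg_nonneg pochhammer_nonneg) auto
qed (use nn_integral_beta1_moment[OF assms, of c d] theta_Beta_eq_pochhammer_ratio[OF assms, of c d] in auto)

section \<open>Mixed moments of the GEM distribution\<close>

text \<open>If \<open>A\<close> is the multiset of sample values, \<open>tail_count A b\<close> is the exponent of \<open>1 - H\<^sub>b\<close> in the
  conditional probability of the sample: each value beyond \<open>b\<close> contributes one such factor.\<close>

definition tail_count :: "nat multiset \<Rightarrow> nat \<Rightarrow> nat" where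
  "tail_count A b = size (filter_mset (\<lambda>x. b < x) A)"

lemma tail_count_pred:
  assumes "b \<ge> 1"
  shows "tail_count A (b - 1) = count A b + tail_count A b"
  using assms by (induction A) (auto simp: tail_count_def)

lemma tail_count_0:
  assumes "\<forall>x\<in>#A. 1 \<le> x" shows "tail_count A 0 = size A"
  using assms by (induction A) (auto simp: tail_count_def)

lemma tail_count_eq_0:
  assumes "\<forall>x\<in>#A. x \<le> m" shows "tail_count A m = 0"
  using assms unfolding tail_count_def by (auto simp: filter_mset_eq_conv)

lemma stick_breaking_expand:
  assumes "x \<in> {1..m}"
  shows "stick_breaking h x =
    (\<Prod>b=1..m. h b ^ count {#x#} b * (1 - h b) ^ tail_count {#x#} b)"
proof -
  have "(\<Prod>b=1..m. h b ^ count {#x#} b) = (\<Prod>b\<in>{1..m}. if b = x then h x else 1)"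
    by (intro prod.cong) auto
  also have "\<dots> = h x" using assms by simp
  finally have 1: "(\<Prod>b=1..m. h b ^ count {#x#} b) = h x" .
  have "(\<Prod>b=1..m. (1 - h b) ^ tail_count {#x#} b) = (\<Prod>b\<in>{1..<x}. (1 - h b) ^ tail_count {#x#} b)"
    using assms by (intro prod.mono_neutral_right) (auto simp: tail_count_def)
  also have "\<dots> = (\<Prod>b=1..<x. 1 - h b)"
    by (intro prod.cong) (auto simp: tail_count_def)
  finally show ?thesis using 1 assms by (simp add: stick_breaking_def prod.distrib)
qed

lemma prod_stick_breaking:
  assumes "set_mset A \<subseteq> {1..m}"
  shows "(\<Prod>x\<in>#A. stick_breaking h x) =
    (\<Prod>b=1..m. h b ^ count A b * (1 - h b) ^ tail_count A b)"
  using assms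
proof (induction A)
  case empty
  then show ?case by (simp add: tail_count_def)
next
  case (add x A)
  have count: "count (add_mset x A) b = count {#x#} b + count A b" for b
    by simp
  have tail: "tail_count (add_mset x A) b = tail_count {#x#} b + tail_count A b" for b
    by (simp add: tail_count_def)
  show ?case
    unfolding count tail power_add
    using add stick_breaking_expand[of x m h] by (simp add: prod.distrib mult_ac)
qed

text \<open>The product rule for integrals over finite products carries over to an arbitrary index set when
  only finitely many coordinates occur, because the restriction of the product measure to those
  coordinates is the finite product measure.\<close>

lemma integral_PiM_prod:
  fixes f :: "'i \<Rightarrow> 'b \<Rightarrow> real"
  assumes M: "\<And>i. prob_space (M i)" and J: "J \<subseteq> I" "finite J"
    and f: "\<And>i. i \<in> J \<Longrightarrow> integrable (M i) (f i)"
  shows "(\<integral>x. (\<Prod>i\<in>J. f i (x i)) \<partial>PiM I M) = (\<Prod>i\<in>J. \<integral>x. f i x \<partial>M i)"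
proof -
  interpret product_prob_space M I
    using M by (simp add: product_prob_space_def product_prob_space_axioms_def
        product_sigma_finite_def prob_space_imp_sigma_finite)
  have [measurable]: "f i \<in> borel_measurable (M i)" if "i \<in> J" for i
    using f[OF that] by auto
  have "(\<Prod>i\<in>J. \<integral>x. f i x \<partial>M i) = (\<integral>x. (\<Prod>i\<in>J. f i (x i)) \<partial>PiM J M)"
    using f J by (intro product_integral_prod[symmetric]) auto
  also have "PiM J M = distr (PiM I M) (PiM J M) (\<lambda>x. restrict x J)"
    using J by (intro distr_PiM_restrict_finite[symmetric]) auto
  also have "(\<integral>x. (\<Prod>i\<in>J. f i (x i)) \<partial>\<dots>) = (\<integral>x. (\<Prod>i\<in>J. f i (restrict x J i)) \<partial>PiM I M)"
    using J by (intro integral_distr) (auto intro!: measurable_restrict_subset borel_measurable_prod)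
  also have "\<dots> = (\<integral>x. (\<Prod>i\<in>J. f i (x i)) \<partial>PiM I M)"
    by (intro Bochner_Integration.integral_cong prod.cong) auto
  finally show ?thesis ..
qed

lemma measurable_stick_breaking [measurable]:
  "stick_breaking \<in> measurable (\<Pi>\<^sub>M j\<in>{1..}. beta1_measure \<theta>) seq_borel"
  unfolding stick_breaking_def
  by (intro measurable_restrict borel_measurable_times borel_measurable_prod
      borel_measurable_diff borel_measurable_const)
    (auto intro!: measurable_component_singleton
      simp flip: measurable_cong_sets[OF refl sets_beta1_measure])

text \<open>Expanding each $P_x$ into its sticks, the exponents of \<open>H\<^sub>b\<close> and \<open>1 - H\<^sub>b\<close> are \<open>count A b\<close> and
  \<open>tail_count A b\<close>, whose sum is \<open>tail_count A (b - 1)\<close>. By independence the moment is a product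
  over the sticks, in which the rising factorials telescope from \<open>tail_count A 0 = size A\<close> down to
  \<open>tail_count A m = 0\<close>. Each stick leaves behind one factor \<open>\<theta> / (tail_count A b + \<theta>)\<close>.\<close>

lemma GEM0_mixed_moment:
  assumes \<theta>: "\<theta> > 0" and A: "set_mset A \<subseteq> {1..m}"
  shows "(\<integral>p. (\<Prod>x\<in>#A. p x) \<partial>GEM0 \<theta>) =
    (\<Prod>b=1..m. fact (count A b)) / pochhammer (\<theta> + 1) (size A) *
    (\<Prod>b=1..m. \<theta> / (real (tail_count A b) + \<theta>))"
proof -
  let ?r = "pochhammer (\<theta> + 1)"
  have r: "?r k \<noteq> 0" for k
    using \<theta> pochhammer_pos[of "\<theta> + 1" k] by linarith
  have "(\<lambda>p. \<Prod>x\<in>#A. p x) \<in> borel_measurable seq_borel"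
    using A
  proof (induction A)
    case (add x A)
    then show ?case
      by (auto intro!: borel_measurable_times measurable_component_singleton)
  qed simp
  then have "(\<integral>p. (\<Prod>x\<in>#A. p x) \<partial>GEM0 \<theta>) =
      (\<integral>h. (\<Prod>x\<in>#A. stick_breaking h x) \<partial>(\<Pi>\<^sub>M j\<in>{1..}. beta1_measure \<theta>))"
    unfolding GEM0_def by (intro integral_distr measurable_stick_breaking)
  also have "\<dots> = (\<integral>h. (\<Prod>b\<in>{1..m}. h b ^ count A b * (1 - h b) ^ tail_count A b)
      \<partial>(\<Pi>\<^sub>M j\<in>{1..}. beta1_measure \<theta>))"
    using prod_stick_breaking[OF A] by simp
  also have "\<dots> = (\<Prod>b\<in>{1..m}. \<integral>x. x ^ count A b * (1 - x) ^ tail_count A b \<partial>beta1_measure \<theta>)"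
    using prob_space_beta1_measure[OF \<theta>] beta1_moment[OF \<theta>]
    by (intro integral_PiM_prod) (auto simp: has_bochner_integral_iff)
  also have "\<dots> = (\<Prod>b=1..m. fact (count A b) * (\<theta> / (real (tail_count A b) + \<theta>)) *
      (?r (tail_count A b) / ?r (tail_count A (b - 1))))"
    using beta1_moment[OF \<theta>] tail_count_pred
    by (intro prod.cong) (auto simp: has_bochner_integral_iff)
  also have "\<dots> = (\<Prod>b=1..m. fact (count A b)) * (\<Prod>b=1..m. \<theta> / (real (tail_count A b) + \<theta>)) *
      (\<Prod>b=Suc 0..m. ?r (tail_count A b) / ?r (tail_count A (b - 1)))"
    by (simp only: prod.distrib One_nat_def)
  also have "(\<Prod>b=Suc 0..m. ?r (tail_count A b) / ?r (tail_count A (b - 1))) =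
      ?r (tail_count A m) / ?r (tail_count A 0)"
    using r by (intro prod_telescope'') auto
  also have "tail_count A m = 0" using A by (intro tail_count_eq_0) auto
  also have "tail_count A 0 = size A" using A by (intro tail_count_0) auto
  finally show ?thesis by simp
qed

section \<open>The law of the unordered sample\<close>

lemma GEM_sample_measurable:
  assumes "GEM_sample M \<theta> P X" "j \<ge> 1"
  shows "X j \<in> measurable M (count_space UNIV)"
    and "\<omega> \<in> space M \<Longrightarrow> X j \<omega> \<ge> 1"
proof -
  have X: "X j \<in> measurable M (count_space {1..})"
    using assms by (simp add: GEM_sample_def Let_def cond_indep_vars_def)
  show "X j \<in> measurable M (count_space UNIV)"
    using measurable_compose[OF X, of "\<lambda>x. x" "count_space UNIV"] by simp
  show "X j \<omega> \<ge> 1" if "\<omega> \<in> space M"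
    using measurable_space[OF X that] by simp
qed

text \<open>Integrate the conditional probability of the event given \<open>P\<close>, which conditional independence
  factorises into $\prod_j P_{x_j}$; only the law of \<open>P\<close> then matters.\<close>

lemma prob_sample_eq_GEM0_moment:
  assumes "prob_space M" and sample: "GEM_sample M \<theta> P X"
    and J: "finite J" "J \<noteq> {}" "J \<subseteq> {1..}" and x: "\<And>j. j \<in> J \<Longrightarrow> x j \<ge> 1"
  shows "measure M {\<omega>\<in>space M. \<forall>j\<in>J. X j \<omega> = x j} = (\<integral>p. (\<Prod>j\<in>J. p (x j)) \<partial>GEM0 \<theta>)"
proof -
  interpret prob_space M by fact
  define F where "F = vimage_algebra (space M) P seq_borel"
  have P [measurable]: "P \<in> measurable M seq_borel" and law: "distr M seq_borel P = GEM0 \<theta>"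
    and indep: "cond_indep_vars M F (\<lambda>_. count_space {1..}) X {1..}"
    and marginal: "\<And>i b. i \<ge> 1 \<Longrightarrow> b \<ge> 1 \<Longrightarrow>
      AE \<omega> in M. cond_prob_given M F {\<omega> \<in> space M. X i \<omega> = b} \<omega> = P \<omega> b"
    using sample by (auto simp: GEM_sample_def Let_def F_def)
  have "subalgebra M F"
    using measurable_space[OF P] measurable_sets[OF P]
    by (auto simp: subalgebra_def F_def sets_vimage_algebra2)
  then interpret finite_measure_subalgebra M F
    by unfold_locales
  define E where "E = {\<omega>\<in>space M. \<forall>j\<in>J. X j \<omega> = x j}"
  have X: "{\<omega>\<in>space M. X j \<omega> = x j} \<in> sets M" if "j \<in> J" for j
    using measurable_sets[OF GEM_sample_measurable(1)[OF sample, of j], of "{x j}"] J that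
    by (auto simp: vimage_def Int_def conj_commute)
  have E_sets: "E \<in> sets M"
    unfolding E_def using J X by (intro sets.sets_Collect_finite_All) auto
  have E_Int: "(\<Inter>j\<in>J. X j -` {x j} \<inter> space M) = E"
    using J by (auto simp: E_def)
  have single: "X j -` {x j} \<inter> space M = {\<omega>\<in>space M. X j \<omega> = x j}" for j
    by auto
  have "(\<lambda>j. {x j}) \<in> Pi J (\<lambda>j. sets (count_space {1..}))"
    using x by auto
  then have "AE \<omega> in M. cond_prob_given M F (\<Inter>j\<in>J. X j -` {x j} \<inter> space M) \<omega>
      = (\<Prod>j\<in>J. cond_prob_given M F (X j -` {x j} \<inter> space M) \<omega>)"
    using indep[unfolded cond_indep_vars_def, THEN conjunct2, rule_format, of J "\<lambda>j. {x j}"] J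
    by simp
  then have "AE \<omega> in M. cond_prob_given M F E \<omega>
      = (\<Prod>j\<in>J. cond_prob_given M F {\<omega>\<in>space M. X j \<omega> = x j} \<omega>)"
    unfolding E_Int unfolding single .
  moreover have "AE \<omega> in M. \<forall>j\<in>J. cond_prob_given M F {\<omega>\<in>space M. X j \<omega> = x j} \<omega> = P \<omega> (x j)"
    using J x marginal by (intro AE_finite_allI) auto
  ultimately have AE: "AE \<omega> in M. cond_prob_given M F E \<omega> = (\<Prod>j\<in>J. P \<omega> (x j))"
    by eventually_elim simp
  have comp: "(\<lambda>p. p (x j)) \<in> borel_measurable seq_borel" if "j \<in> J" for j
    using x[OF that] by (intro measurable_component_singleton) auto
  have "measure M E = (\<integral>\<omega>. indicator E \<omega> \<partial>M)"
    using E_sets by simp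
  also have "\<dots> = (\<integral>\<omega>. cond_prob_given M F E \<omega> \<partial>M)"
    unfolding cond_prob_given_def using E_sets
    by (intro real_cond_exp_int(2)[symmetric]) (auto simp: integrable_indicator_iff emeasure_eq_measure)
  also have "\<dots> = (\<integral>\<omega>. (\<Prod>j\<in>J. P \<omega> (x j)) \<partial>M)"
    using AE comp
    by (intro integral_cong_AE borel_measurable_prod measurable_compose[OF P])
      (auto simp: cond_prob_given_def)
  also have "\<dots> = (\<integral>p. (\<Prod>j\<in>J. p (x j)) \<partial>distr M seq_borel P)"
    using comp by (intro integral_distr[symmetric] P borel_measurable_prod)
  finally show ?thesis unfolding law E_def .
qed

lemma map_nth_upt_Suc: "map (\<lambda>j. xs ! (j - 1)) [1..<Suc (length xs)] = xs"
  by (rule nth_equalityI) (simp_all del: upt_Suc)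

lemma map_upt_eq_iff:
  assumes "length xs = n"
  shows "map f [1..<Suc n] = xs \<longleftrightarrow> (\<forall>j\<in>{1..n}. f j = xs ! (j - 1))"
  by (subst map_nth_upt_Suc[of xs, symmetric]) (auto simp: assms simp del: upt_Suc)

lemma sets_sample_list:
  assumes "GEM_sample M \<theta> P X"
  shows "{\<omega>\<in>space M. map (\<lambda>j. X j \<omega>) [1..<Suc n] = xs} \<in> sets M"
proof (cases "length xs = n")
  case True
  have "{\<omega>\<in>space M. map (\<lambda>j. X j \<omega>) [1..<Suc n] = xs} =
      {\<omega>\<in>space M. \<forall>j\<in>{1..n}. X j \<omega> = xs ! (j - 1)}"
    using map_upt_eq_iff[OF True] by (simp del: upt_Suc)
  also have "\<dots> \<in> sets M"
  proof (intro sets.sets_Collect_finite_All)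
    fix j assume "j \<in> {1..n}"
    then show "{\<omega>\<in>space M. X j \<omega> = xs ! (j - 1)} \<in> sets M"
      using measurable_sets[OF GEM_sample_measurable(1)[OF assms, of j], of "{xs ! (j - 1)}"]
      by (auto simp: vimage_def Int_def conj_commute)
  qed auto
  finally show ?thesis .
next
  case False
  then have "{\<omega>\<in>space M. map (\<lambda>j. X j \<omega>) [1..<Suc n] = xs} = {}"
    by auto
  then show ?thesis by (metis sets.empty_sets)
qed

lemma fact_div_pochhammer:
  fixes \<theta> :: real
  shows "fact n / pochhammer (\<theta> + 1) n = (\<Prod>i=1..n. real i / (real i + \<theta>))"
proof (induction n)
  case (Suc n)
  have "fact (Suc n) / pochhammer (\<theta> + 1) (Suc n) =
      (fact n / pochhammer (\<theta> + 1) n) * (real (Suc n) / (real (Suc n) + \<theta>))"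
    by (simp add: pochhammer_Suc add_ac mult_ac)
  then show ?case using Suc by simp
qed simp

text \<open>All orderings of \<open>A\<close> have the same probability, a mixed moment of \<open>GEM0 \<theta>\<close>. The number of
  orderings is the multinomial coefficient, whose denominator cancels the factorials in that
  moment. What remains depends on \<open>A\<close> only through its tail counts.\<close>

lemma prob_sample_mset:
  assumes "prob_space M" and \<theta>: "\<theta> > 0" and sample: "GEM_sample M \<theta> P X"
    and n: "n \<ge> 1" "size A = n" and A: "set_mset A \<subseteq> {1..m}"
  shows "measure M {\<omega>\<in>space M. mset (map (\<lambda>j. X j \<omega>) [1..<Suc n]) = A} =
    (\<Prod>i=1..n. real i / (real i + \<theta>)) * (\<Prod>b=1..m. \<theta> / (real (tail_count A b) + \<theta>))"
proof -
  interpret prob_space M by fact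
  let ?xs = "\<lambda>\<omega>. map (\<lambda>j. X j \<omega>) [1..<Suc n]" and ?perms = "permutations_of_multiset A"
  let ?moment = "\<integral>p. (\<Prod>x\<in>#A. p x) \<partial>GEM0 \<theta>"
  have ordered: "prob {\<omega>\<in>space M. ?xs \<omega> = xs} = ?moment" if "xs \<in> ?perms" for xs
  proof -
    have xs: "mset xs = A" "length xs = n"
      using permutations_of_multisetD[OF that] n by (auto simp flip: size_mset)
    have list: "map (\<lambda>j. xs ! (j - 1)) [1..<Suc n] = xs"
      using map_nth_upt_Suc[of xs] xs by simp
    have "?xs \<omega> = xs \<longleftrightarrow> (\<forall>j\<in>{1..n}. X j \<omega> = xs ! (j - 1))" for \<omega>
      by (rule map_upt_eq_iff[OF xs(2)])
    moreover have "xs ! (j - 1) \<ge> 1" if "j \<in> {1..n}" for j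
    proof -
      have "xs ! (j - 1) \<in> set xs"
        using that xs by (intro nth_mem) auto
      then show ?thesis using xs A by fastforce
    qed
    ultimately have "prob {\<omega>\<in>space M. ?xs \<omega> = xs} =
        (\<integral>p. (\<Prod>j=1..n. p (xs ! (j - 1))) \<partial>GEM0 \<theta>)"
      using n prob_sample_eq_GEM0_moment[OF \<open>prob_space M\<close> sample, of "{1..n}" "\<lambda>j. xs ! (j - 1)"]
      by (simp del: upt_Suc)
    moreover have "(\<Prod>j=1..n. p (xs ! (j - 1))) = (\<Prod>x\<in>#A. p x)" for p :: "nat \<Rightarrow> real"
    proof -
      have "(\<Prod>x\<in>#A. p x) = prod_list (map (\<lambda>j. p (xs ! (j - 1))) [1..<Suc n])"
        unfolding xs(1)[symmetric]
        by (subst (1) list[symmetric])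
          (simp add: comp_def prod_mset_prod_list flip: mset_map del: upt_Suc mset_map)
      also have "\<dots> = (\<Prod>j=1..n. p (xs ! (j - 1)))"
        by (subst prod.distinct_set_conv_list[symmetric])
          (auto simp: atLeastLessThanSuc_atLeastAtMost simp del: upt_Suc)
      finally show ?thesis ..
    qed
    ultimately show ?thesis by simp
  qed
  have "{\<omega>\<in>space M. mset (?xs \<omega>) = A} = (\<Union>xs\<in>?perms. {\<omega>\<in>space M. ?xs \<omega> = xs})"
    by (auto simp: permutations_of_multiset_def simp del: upt_Suc)
  also have "prob \<dots> = (\<Sum>xs\<in>?perms. prob {\<omega>\<in>space M. ?xs \<omega> = xs})"
    using sets_sample_list[OF sample, of n]
    by (intro finite_measure_finite_Union) (auto simp: disjoint_family_on_def simp del: upt_Suc)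
  also have "\<dots> = real (card ?perms) * ?moment"
    using ordered by simp
  also have "\<dots> = (real (card ?perms) * (\<Prod>b=1..m. fact (count A b))) / pochhammer (\<theta> + 1) n *
      (\<Prod>b=1..m. \<theta> / (real (tail_count A b) + \<theta>))"
    using GEM0_mixed_moment[OF \<theta> A] n by simp
  also have "(\<Prod>b=1..m. fact (count A b) :: real) = (\<Prod>b\<in>set_mset A. fact (count A b))"
    using A by (intro prod.mono_neutral_right) (auto simp: not_in_iff)
  also have "real (card ?perms) * \<dots> = fact n"
    using arg_cong[OF card_permutations_of_multiset_aux[of A], of real] n by simp
  finally show ?thesis
    using fact_div_pochhammer[of n \<theta>] by simp
qed

section \<open>Gaps and the unordered sample\<close>

lemma measurable_gap:
  assumes "GEM_sample M \<theta> P X"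
  shows "gap X n i \<in> measurable M (count_space UNIV)"
proof -
  have list: "(\<lambda>\<omega>. map (\<lambda>j. X j \<omega>) [1..<Suc n]) \<in> measurable M (count_space UNIV)"
    using sets_sample_list[OF assms, of n]
    by (auto simp: measurable_count_space_eq2_countable vimage_def Int_def conj_commute simp del: upt_Suc)
  define G where "G xs = (if i < n then sort xs ! (n - i) - sort xs ! (n - i - 1)
    else sort xs ! 0 - 1)" for xs :: "nat list"
  have "gap X n i = (\<lambda>\<omega>. G (map (\<lambda>j. X j \<omega>) [1..<Suc n]))"
    by (auto simp: gap_def order_stat_def G_def fun_eq_iff simp del: upt_Suc)
  then show ?thesis
    using measurable_compose[OF list, of G "count_space UNIV"] by (simp del: upt_Suc)
qed

text \<open>The value of the order statistic $X_{n+1-i:n}$ when the gaps are \<open>g\<close>. At \<open>i = n + 1\<close> the sum is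
  empty and the value is 1, so that the gap at \<open>i = n\<close>, the minimum less 1, is a difference of
  consecutive levels like the others.\<close>

definition level :: "nat \<Rightarrow> (nat \<Rightarrow> nat) \<Rightarrow> nat \<Rightarrow> nat" where
  "level n g i = Suc (\<Sum>j=i..n. g j)"

lemma level_step: "i \<le> n \<Longrightarrow> level n g i = g i + level n g (Suc i)"
  by (simp add: level_def sum.atLeast_Suc_atMost)

lemma level_Suc_n: "level n g (Suc n) = 1"
  by (simp add: level_def)

lemma level_antimono: "i \<le> k \<Longrightarrow> level n g k \<le> level n g i"
  unfolding level_def by (auto intro!: sum_mono2)

text \<open>The gaps determine the sorted sample from its smallest entry upwards, and the sorted sample is
  determined by the multiset of sample values.\<close>

lemma gap_eq_iff_mset_eq:
  assumes pos: "\<And>j. j \<in> {1..n} \<Longrightarrow> X j \<omega> \<ge> 1"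
  shows "(\<forall>i\<in>{1..n}. gap X n i \<omega> = g i) \<longleftrightarrow>
    mset (map (\<lambda>j. X j \<omega>) [1..<Suc n]) = image_mset (level n g) (mset_set {1..n})"
proof -
  define xs where "xs = map (\<lambda>j. X j \<omega>) [1..<Suc n]"
  define s where "s = sort xs"
  define L where "L = rev (map (level n g) [1..<Suc n])"
  have len: "length s = n" "length L = n"
    by (simp_all add: s_def xs_def L_def del: upt_Suc)
  have L_nth: "L ! d = level n g (n - d)" if "d < n" for d
    using that by (simp add: L_def rev_nth Suc_diff_Suc del: upt_Suc)
  have mset_L: "mset L = image_mset (level n g) (mset_set {1..n})"
    by (simp add: L_def atLeastLessThanSuc_atLeastAtMost del: upt_Suc)
  have sorted_L: "sorted L"
    unfolding sorted_iff_nth_mono using len L_nth by (auto intro!: level_antimono)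
  have gap: "gap X n i \<omega> = (if i < n then s ! (n - i) - s ! (n - i - 1) else s ! 0 - 1)" for i
    by (simp add: gap_def order_stat_def s_def xs_def del: upt_Suc)
  have "set s = (\<lambda>j. X j \<omega>) ` {1..n}"
    by (auto simp: s_def xs_def)
  then have s_pos: "s ! d \<ge> 1" if "d < n" for d
    using pos nth_mem[of d s] that len by auto
  have "(\<forall>i\<in>{1..n}. gap X n i \<omega> = g i) \<longleftrightarrow> s = L"
  proof
    assume gaps: "\<forall>i\<in>{1..n}. gap X n i \<omega> = g i"
    have "d < n \<Longrightarrow> s ! d = level n g (n - d)" for d
    proof (induction d)
      case 0
      then show ?case
        using gaps[rule_format, of n] s_pos[of 0] by (simp add: gap level_def)
    next
      case (Suc d)
      have "s ! d \<le> s ! Suc d"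
        using Suc.prems len by (intro sorted_nth_mono) (auto simp: s_def)
      moreover have "s ! Suc d - s ! d = g (n - Suc d)"
        using gaps[rule_format, of "n - Suc d"] Suc.prems by (simp add: gap Suc_diff_Suc)
      moreover have "level n g (n - Suc d) = g (n - Suc d) + level n g (n - d)"
        using level_step[of "n - Suc d" n g] Suc.prems by (simp add: Suc_diff_Suc)
      moreover have "s ! d = level n g (n - d)"
        using Suc by simp
      ultimately show ?case by linarith
    qed
    then show "s = L" using len L_nth by (intro nth_equalityI) auto
  next
    assume "s = L"
    then have s_nth: "s ! d = level n g (n - d)" if "d < n" for d
      using L_nth that by simp
    show "\<forall>i\<in>{1..n}. gap X n i \<omega> = g i"
    proof
      fix i assume "i \<in> {1..n}"
      then show "gap X n i \<omega> = g i"
        using level_step[of i n g] by (auto simp: gap s_nth level_Suc_n)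
    qed
  qed
  also have "\<dots> \<longleftrightarrow> mset xs = mset L"
    using properties_for_sort[OF _ sorted_L, of xs] by (auto simp: s_def)
  finally show ?thesis by (simp add: mset_L xs_def del: upt_Suc)
qed

text \<open>Levels decrease in the index, so those beyond \<open>b\<close> are the ones with indices $1,\dots,i$ for
  some \<open>i\<close>.\<close>

lemma card_level_above_iff:
  assumes i: "i \<in> {1..n}" and b: "b \<ge> 1"
  shows "card {k\<in>{1..n}. b < level n g k} = i \<longleftrightarrow> level n g (Suc i) \<le> b \<and> b < level n g i"
proof
  assume *: "level n g (Suc i) \<le> b \<and> b < level n g i"
  have "k \<le> i" if "b < level n g k" for k
    using * that level_antimono[of "Suc i" k n g] by (rule_tac ccontr) auto
  moreover have "b < level n g k" if "k \<le> i" for k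
    using * that level_antimono[of k i n g] by auto
  ultimately have "{k\<in>{1..n}. b < level n g k} = {1..i}"
    using i by auto
  then show "card {k\<in>{1..n}. b < level n g k} = i" by simp
next
  assume card: "card {k\<in>{1..n}. b < level n g k} = i"
  have "b < level n g i"
  proof (rule ccontr)
    assume "\<not> b < level n g i"
    then have "{k\<in>{1..n}. b < level n g k} \<subseteq> {1..<i}"
      using level_antimono[of i _ n g] by (auto simp: not_less) (meson leI le_less_trans not_less)
    then have "card {k\<in>{1..n}. b < level n g k} \<le> card {1..<i}"
      by (intro card_mono) auto
    then show False using card i by auto
  qed
  moreover have "level n g (Suc i) \<le> b"
  proof (rule ccontr)
    assume *: "\<not> level n g (Suc i) \<le> b"
    then have "i < n" using level_Suc_n[of n g] b i by (cases "i = n") auto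
    then have "{1..Suc i} \<subseteq> {k\<in>{1..n}. b < level n g k}"
      using * level_antimono[of _ "Suc i" n g] by (auto simp: not_le intro: less_le_trans)
    then have "card {1..Suc i} \<le> card {k\<in>{1..n}. b < level n g k}"
      by (intro card_mono) auto
    then show False using card by simp
  qed
  ultimately show "level n g (Suc i) \<le> b \<and> b < level n g i" by simp
qed

text \<open>Group the values \<open>b\<close> according to the number of levels beyond \<open>b\<close>. The values with exactly
  \<open>i \<ge> 1\<close> levels beyond them fill the gap \<open>{level n g (Suc i)..<level n g i}\<close>, so there are \<open>g i\<close>
  of them; only the largest level has none beyond it, and there \<open>q 0 = 1\<close>.\<close>

lemma prod_over_values_eq_prod_over_gaps:
  fixes q :: "nat \<Rightarrow> real"
  assumes "q 0 = 1"
  shows "(\<Prod>b=1..level n g 1. q (card {k\<in>{1..n}. b < level n g k})) = (\<Prod>i=1..n. q i ^ g i)"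
proof -
  let ?S = "{1..level n g 1}" and ?f = "\<lambda>b. card {k\<in>{1..n}. b < level n g k}"
  have "?f b \<le> n" for b
    using card_mono[of "{1..n}" "{k\<in>{1..n}. b < level n g k}"] by (simp add: subset_iff)
  then have "(\<Prod>b\<in>?S. q (?f b)) = (\<Prod>i\<in>{0..n}. \<Prod>b\<in>{b\<in>?S. ?f b = i}. q (?f b))"
    by (intro prod.group[symmetric]) auto
  also have "\<dots> = (\<Prod>i\<in>{1..n}. \<Prod>b\<in>{b\<in>?S. ?f b = i}. q (?f b))"
    using assms by (intro prod.mono_neutral_right) (auto simp: not_less_eq_eq)
  also have "\<dots> = (\<Prod>i\<in>{1..n}. q i ^ g i)"
  proof (rule prod.cong)
    fix i assume i: "i \<in> {1..n}"
    have "{b\<in>?S. ?f b = i} = {level n g (Suc i)..<level n g i}"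
    proof (intro set_eqI iffI)
      fix b assume "b \<in> {b\<in>?S. ?f b = i}"
      then show "b \<in> {level n g (Suc i)..<level n g i}"
        using card_level_above_iff[OF i, of b g] by auto
    next
      fix b assume b: "b \<in> {level n g (Suc i)..<level n g i}"
      moreover have "b \<ge> 1" using b by (auto simp: level_def)
      moreover have "level n g i \<le> level n g 1" using i by (intro level_antimono) auto
      ultimately show "b \<in> {b\<in>?S. ?f b = i}"
        using card_level_above_iff[OF i, of b g] by auto
    qed
    then have "card {b\<in>?S. ?f b = i} = g i"
      using level_step[of i n g] i by simp
    moreover have "(\<Prod>b\<in>{b\<in>?S. ?f b = i}. q (?f b)) = (\<Prod>b\<in>{b\<in>?S. ?f b = i}. q i)"
      by (intro prod.cong) auto
    ultimately show "(\<Prod>b\<in>{b\<in>?S. ?f b = i}. q (?f b)) = q i ^ g i" by simp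
  qed simp
  finally show ?thesis .
qed

lemma tail_count_image_mset:
  assumes "finite I"
  shows "tail_count (image_mset f (mset_set I)) b = card {i\<in>I. b < f i}"
  using assms by (simp add: tail_count_def filter_mset_image_mset)

section \<open>The joint law of the gaps\<close>

text \<open>On a countable space a measure is determined by its atoms, so a joint mass function of product
  form identifies the joint law with the product measure, whose projections are the marginal laws.\<close>

lemma (in prob_space) indep_vars_of_joint_pmf:
  fixes Y :: "'i \<Rightarrow> 'a \<Rightarrow> 'b :: countable"
  assumes I: "finite I" "I \<noteq> {}"
    and Y [measurable]: "\<And>i. i \<in> I \<Longrightarrow> Y i \<in> measurable M (count_space UNIV)"
    and joint: "\<And>y. prob {\<omega>\<in>space M. \<forall>i\<in>I. Y i \<omega> = y i} = (\<Prod>i\<in>I. pmf (q i) (y i))"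
  shows "indep_vars (\<lambda>_. count_space UNIV) Y I"
    and "\<And>i. i \<in> I \<Longrightarrow> distr M (count_space UNIV) (Y i) = measure_pmf (q i)"
proof -
  let ?C = "\<lambda>_::'i. count_space (UNIV :: 'b set)" and ?Y = "\<lambda>\<omega>. \<lambda>i\<in>I. Y i \<omega>"
  interpret Q: finite_product_prob_space "\<lambda>i. measure_pmf (q i)" I
    by unfold_locales fact
  have C: "PiM I ?C = count_space (PiE I (\<lambda>_. UNIV))"
    using I by (intro count_space_PiM_finite) auto
  have sets_Q: "sets (PiM I (\<lambda>i. measure_pmf (q i))) = sets (PiM I ?C)"
    by (intro sets_PiM_cong) auto
  have mY: "?Y \<in> measurable M (PiM I ?C)"
    using Y by (intro measurable_restrict)
  have joint_law: "distr M (PiM I ?C) ?Y = PiM I (\<lambda>i. measure_pmf (q i))"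
  proof (rule measure_eqI_countable)
    show "sets (distr M (PiM I ?C) ?Y) = Pow (PiE I (\<lambda>_. UNIV))"
      by (simp add: C)
    show "sets (PiM I (\<lambda>i. measure_pmf (q i))) = Pow (PiE I (\<lambda>_. UNIV))"
      unfolding sets_Q by (simp add: C)
    show "countable (PiE I (\<lambda>_. UNIV :: 'b set))"
      using I by (intro countable_PiE) auto
    fix y :: "'i \<Rightarrow> 'b" assume y: "y \<in> PiE I (\<lambda>_. UNIV)"
    have "?Y -` {y} \<inter> space M = {\<omega>\<in>space M. \<forall>i\<in>I. Y i \<omega> = y i}"
      using y by (auto simp: PiE_def extensional_def fun_eq_iff)
    then have "emeasure (distr M (PiM I ?C) ?Y) {y} = ennreal (\<Prod>i\<in>I. pmf (q i) (y i))"
      using y mY joint[of y] by (subst emeasure_distr) (auto simp: C emeasure_eq_measure)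
    also have "\<dots> = (\<Prod>i\<in>I. emeasure (measure_pmf (q i)) {y i})"
      by (simp add: emeasure_pmf_single prod_ennreal)
    also have "\<dots> = emeasure (PiM I (\<lambda>i. measure_pmf (q i))) (PiE I (\<lambda>i. {y i}))"
      using I by (intro Q.emeasure_PiM[symmetric]) auto
    also have "PiE I (\<lambda>i. {y i}) = {y}"
      using y by (intro PiE_singleton) (auto simp: PiE_def)
    finally show "emeasure (distr M (PiM I ?C) ?Y) {y} =
      emeasure (PiM I (\<lambda>i. measure_pmf (q i))) {y}" .
  qed
  show marginal: "distr M (count_space UNIV) (Y i) = measure_pmf (q i)" if i: "i \<in> I" for i
  proof -
    have "measure_pmf (q i) =
        distr (distr M (PiM I ?C) ?Y) (measure_pmf (q i)) (\<lambda>y. y i)"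
      unfolding joint_law by (rule Q.PiM_component[OF i, symmetric])
    also have "\<dots> = distr (distr M (PiM I ?C) ?Y) (count_space UNIV) (\<lambda>y. y i)"
      by (intro distr_cong) auto
    also have "\<dots> = distr M (count_space UNIV) ((\<lambda>y. y i) \<circ> ?Y)"
      using mY i by (intro distr_distr measurable_component_singleton)
    also have "(\<lambda>y. y i) \<circ> ?Y = Y i"
      using i by (simp add: comp_def)
    finally show ?thesis ..
  qed
  have "(\<Pi>\<^sub>M i\<in>I. distr M (count_space UNIV) (Y i)) = PiM I (\<lambda>i. measure_pmf (q i))"
    using marginal by (intro PiM_cong) auto
  then show "indep_vars (\<lambda>_. count_space UNIV) Y I"
    using joint_law I Y by (subst indep_vars_iff_distr_eq_PiM') auto
qed

text \<open>The product over the values \<open>b\<close> left by the previous computation becomes a product over the gaps: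
  a value with \<open>i\<close> sample points beyond it lies in the \<open>i\<close>-th gap and contributes the failure
  probability \<open>\<theta> / (i + \<theta>)\<close> of the geometric distribution of that gap.\<close>

lemma prob_gaps_eq_prod_geometric:
  assumes "prob_space M" and \<theta>: "\<theta> > 0" and sample: "GEM_sample M \<theta> P X" and n: "n \<ge> 1"
  shows "measure M {\<omega>\<in>space M. \<forall>i\<in>{1..n}. gap X n i \<omega> = g i} =
    (\<Prod>i=1..n. pmf (geometric_pmf (real i / (real i + \<theta>))) (g i))"
proof -
  define A where "A = image_mset (level n g) (mset_set {1..n})"
  define q where "q i = \<theta> / (real i + \<theta>)" for i
  have "{\<omega>\<in>space M. \<forall>i\<in>{1..n}. gap X n i \<omega> = g i} =
      {\<omega>\<in>space M. mset (map (\<lambda>j. X j \<omega>) [1..<Suc n]) = A}"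
    using gap_eq_iff_mset_eq[of n X _ g] GEM_sample_measurable(2)[OF sample]
    unfolding A_def by (intro Collect_cong conj_cong refl) auto
  moreover have "set_mset A \<subseteq> {1..level n g 1}"
    using level_antimono[of 1 _ n g] by (auto simp: A_def level_def)
  ultimately have "measure M {\<omega>\<in>space M. \<forall>i\<in>{1..n}. gap X n i \<omega> = g i} =
      (\<Prod>i=1..n. real i / (real i + \<theta>)) * (\<Prod>b=1..level n g 1. q (tail_count A b))"
    using prob_sample_mset[OF \<open>prob_space M\<close> \<theta> sample n] by (simp add: A_def q_def del: upt_Suc)
  also have "(\<Prod>b=1..level n g 1. q (tail_count A b)) = (\<Prod>i=1..n. q i ^ g i)"
    using prod_over_values_eq_prod_over_gaps[of q n g] \<theta>
    by (simp add: A_def tail_count_image_mset q_def)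
  also have "(\<Prod>i=1..n. real i / (real i + \<theta>)) * \<dots> =
      (\<Prod>i=1..n. pmf (geometric_pmf (real i / (real i + \<theta>))) (g i))"
    unfolding prod.distrib[symmetric]
  proof (rule prod.cong)
    fix i assume i: "i \<in> {1..n}"
    have "1 - real i / (real i + \<theta>) = q i"
      using \<theta> by (simp add: q_def field_simps)
    then show "real i / (real i + \<theta>) * q i ^ g i =
        pmf (geometric_pmf (real i / (real i + \<theta>))) (g i)"
      using \<theta> i by (subst pmf_geometric) auto
  qed simp
  finally show ?thesis .
qed

theorem theorem1p1:
  fixes M :: "'a measure" and \<theta> :: real and P :: "'a \<Rightarrow> nat \<Rightarrow> real"
    and X :: "nat \<Rightarrow> 'a \<Rightarrow> nat" and n :: nat
  assumes "prob_space M" and "\<theta> > 0" and "GEM_sample M \<theta> P X" and "n \<ge> 1"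
  shows "prob_space.indep_vars M (\<lambda>_. count_space UNIV) (gap X n) {1..n} \<and>
    (\<forall>i\<in>{1..n}.
       distr M (count_space UNIV) (gap X n i) = measure_pmf (geometric_pmf (real i / (real i + \<theta>))) \<and>
       integrable M (\<lambda>\<omega>. real (gap X n i \<omega>)) \<and>
       prob_space.expectation M (\<lambda>\<omega>. real (gap X n i \<omega>)) = \<theta> / real i)"
proof -
  interpret prob_space M by fact
  note gap [measurable] = measurable_gap[OF assms(3), of n]
  note joint = prob_gaps_eq_prod_geometric[OF assms]
  have "indep_vars (\<lambda>_. count_space UNIV) (gap X n) {1..n}"
    using assms(4) gap joint by (intro indep_vars_of_joint_pmf(1)) auto
  moreover have "distr M (count_space UNIV) (gap X n i) =
         measure_pmf (geometric_pmf (real i / (real i + \<theta>))) \<and>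
       integrable M (\<lambda>\<omega>. real (gap X n i \<omega>)) \<and>
       expectation (\<lambda>\<omega>. real (gap X n i \<omega>)) = \<theta> / real i" if i: "i \<in> {1..n}" for i
  proof (intro conjI)
    let ?p = "real i / (real i + \<theta>)"
    have p: "?p \<in> {0<..1}" using assms(2) i by auto
    show law: "distr M (count_space UNIV) (gap X n i) = measure_pmf (geometric_pmf ?p)"
      using assms(4) gap joint i
      by (intro indep_vars_of_joint_pmf(2)[where I = "{1..n}" and
            q = "\<lambda>i. geometric_pmf (real i / (real i + \<theta>))"]) auto
    show "integrable M (\<lambda>\<omega>. real (gap X n i \<omega>))"
      using integrable_real_geometric_pmf[OF p]
      by (subst (asm) law[symmetric]) (simp add: integrable_distr_eq)
    have "expectation (\<lambda>\<omega>. real (gap X n i \<omega>)) = (\<integral>x. real x \<partial>distr M (count_space UNIV) (gap X n i))"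
      by (simp add: integral_distr)
    also have "\<dots> = (1 - ?p) / ?p"
      unfolding law by (rule expectation_geometric_pmf[OF p])
    also have "1 - ?p = \<theta> / (real i + \<theta>)"
      using assms(2) by (simp add: field_simps)
    also have "\<theta> / (real i + \<theta>) / ?p = \<theta> / real i"
      using assms(2) i by simp
    finally show "expectation (\<lambda>\<omega>. real (gap X n i \<omega>)) = \<theta> / real i" .
  qed
  ultimately show ?thesis by blast
qed

end
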